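(* Consider the discrete-time system $\Sigma$ given by $x(k+1)=f(x(k))+d(k)$, $k\in\mathbb{N}$, defined on a metric space $X$ (the state space, $X\subset\mathbb{R}^n$). Consider $x\in X$ and an LTL$_F$ specification $\psi$. If the map $f:\mathbb{R}^n\to\mathbb{R}^n$ is continuous and if $\psi$ is closed, then $$g_\psi(x)=\begin{cases}\max\{\varepsilon\ge 0\mid\xi(x,\varepsilon)\vDash\psi\},&\text{if }\xi(x,0)\vDash\psi,\\ 0,&\text{if }\xi(x,0)\nvDash\psi,\end{cases}$$ that is, the supremum in the definition of the resilience $g_\psi(x)$ can be replaced by a maximum.
   Context: Let $\mathsf{AP}$ be a finite set of atomic propositions and $\mathsf{L}:X\to 2^{\mathsf{AP}}$ a measurable labeling function. LTL$_F$ formulas over $\mathsf{AP}$ are built inductively as $\psi::=\mathsf{true}\mid p\mid\neg\psi\mid\psi_1\wedge\psi_2\mid\psi_1\vee\psi_2\mid\bigcirc\psi\mid\psi_1\,\mathsf{U}\,\psi_2\mid\square\psi\mid\lozenge\psi$ with $p\in\mathsf{AP}$. For a finite word $\omega=(\omega_0,\dots,\omega_{N-1})$ with letters in $2^{\mathsf{AP}}$, satisfaction at step $i<N$ is defined by: $\omega_i\vDash\mathsf{true}$ always holds; $\omega_i\vDash p$ if $p\in\omega_i$; $\omega_i\vDash\neg\psi$ if $\omega_i\nvDash\psi$; $\wedge$ and $\vee$ are interpreted as "and" and "or"; $\omega_i\vDash\bigcirc\psi$ if $\omega_{i+1}\vDash\psi$; $\omega_i\vDash\psi_1\,\mathsf{U}\,\psi_2$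 if for some $m$ with $i\le m<N$ we have $\omega_m\vDash\psi_2$ and $\omega_k\vDash\psi_1$ for all $i\le k<m$; $\omega_i\vDash\square\psi$ (resp. $\lozenge\psi$) if $\omega_m\vDash\psi$ for all (resp. some) $i\le m<N$. One writes $\omega\vDash\psi$ iff $\omega_0\vDash\psi$. A trajectory $w=(x_0,\dots,x_{N-1})\in X^N$ of length $N$ satisfies $\psi$ iff the word $(\mathsf{L}(x_0),\dots,\mathsf{L}(x_{N-1}))$ does; a set of trajectories satisfies $\psi$ iff all of its elements do. For $\varepsilon\ge 0$ let $\Omega_\varepsilon(0)=\{z\in\mathbb{R}^n:\|z\|_\infty\le\varepsilon\}$, and let $\xi(x,\varepsilon)$ be the set of trajectories $(x_0,x_1,x_2,\dots)$ of the system with $x_0=x$ and $x_{k+1}\in f(x_k)+\Omega_\varepsilon(0)$; $\xi(x,0)$ contains only the disturbance-free trajectory from $x$. The resilience is $g_\psi(x)=\sup\{\varepsilon\ge 0\mid\xi(x,\varepsilon)\vDash\psi\}\in\mathbb{R}_{\ge0}\cup\{+\infty\}$ if $\xi(x,0)\vDash\psi$, and $g_\psi(x)=0$ if $\xi(x,0)\nvDash\psi$. The limit of a sequence of trajectories $w_i=(x_{0,i},x_{1,i},x_{2,i},\dots)$, $i\in\mathbb{N}$, is the element-wise limit $w=(x_0,x_1,x_2,\dots)$ with $x_j=\lim_{i\to\infty}x_{j,i}$ for all $j$; the sequence is converging whenever this limit exists. The formula $\psi$ is closed if for any converging sequence of trajectories $(w_i)_{i\in\mathbb{N}}$ with $w_i\vDash\psi$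 for all $i\in\mathbb{N}$, the limit satisfies $\lim_{i\to\infty}w_i\vDash\psi$.
   Formalization: If ξ(x,ε) ⊨ ψ holds for arbitrarily large ε (e.g. ψ = true), the set has no maximum; the maximum is then read as +∞, which equals g_ψ(x). Element-wise limits are taken in ℝⁿ, and a trajectory leaving X counts as not satisfying ψ. *)

theory Defs
  imports "HOL-Analysis.Analysis"
begin

datatype 'ap ltlf =
    TrueF
  | Atom 'ap
  | Not "'ap ltlf"
  | And "'ap ltlf" "'ap ltlf"
  | Or "'ap ltlf" "'ap ltlf"
  | Next "'ap ltlf"
  | Until "'ap ltlf" "'ap ltlf"
  | Box "'ap ltlf"
  | Diamond "'ap ltlf"

text \<open>
  Satisfaction at step \<open>i\<close> of a finite word; it is meaningful for \<open>i < length \<omega>\<close> only.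
  Consequently \<open>Next\<close> is the strong next operator: it fails at the last letter.
\<close>

primrec sat_at :: "'ap set list \<Rightarrow> nat \<Rightarrow> 'ap ltlf \<Rightarrow> bool" where
  "sat_at \<omega> i TrueF \<longleftrightarrow> True"
| "sat_at \<omega> i (Atom p) \<longleftrightarrow> p \<in> \<omega> ! i"
| "sat_at \<omega> i (Not \<psi>) \<longleftrightarrow> \<not> sat_at \<omega> i \<psi>"
| "sat_at \<omega> i (And \<psi>1 \<psi>2) \<longleftrightarrow> sat_at \<omega> i \<psi>1 \<and> sat_at \<omega> i \<psi>2"
| "sat_at \<omega> i (Or \<psi>1 \<psi>2) \<longleftrightarrow> sat_at \<omega> i \<psi>1 \<or> sat_at \<omega> i \<psi>2"
| "sat_at \<omega> i (Next \<psi>) \<longleftrightarrow> Suc i < length \<omega> \<and> sat_at \<omega> (Suc i) \<psi>"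
| "sat_at \<omega> i (Until \<psi>1 \<psi>2) \<longleftrightarrow>
     (\<exists>m. i \<le> m \<and> m < length \<omega> \<and> sat_at \<omega> m \<psi>2 \<and> (\<forall>k. i \<le> k \<and> k < m \<longrightarrow> sat_at \<omega> k \<psi>1))"
| "sat_at \<omega> i (Box \<psi>) \<longleftrightarrow> (\<forall>m. i \<le> m \<and> m < length \<omega> \<longrightarrow> sat_at \<omega> m \<psi>)"
| "sat_at \<omega> i (Diamond \<psi>) \<longleftrightarrow> (\<exists>m. i \<le> m \<and> m < length \<omega> \<and> sat_at \<omega> m \<psi>)"

definition word_sat :: "'ap set list \<Rightarrow> 'ap ltlf \<Rightarrow> bool" where
  "word_sat \<omega> \<psi> \<longleftrightarrow> sat_at \<omega> 0 \<psi>"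

text \<open>
  The labeling is defined on the state space \<open>X\<close> only, so the values of \<open>L\<close> outside \<open>X\<close> must
  not matter: a sequence of points that leaves \<open>X\<close> satisfies no specification.
\<close>

definition traj_sat ::
  "'a set \<Rightarrow> ('a \<Rightarrow> 'ap set) \<Rightarrow> 'a list \<Rightarrow> 'ap ltlf \<Rightarrow> bool" where
  "traj_sat X L w \<psi> \<longleftrightarrow> set w \<subseteq> X \<and> word_sat (map L w) \<psi>"

definition trajs_sat ::
  "'a set \<Rightarrow> ('a \<Rightarrow> 'ap set) \<Rightarrow> 'a list set \<Rightarrow> 'ap ltlf \<Rightarrow> bool" where
  "trajs_sat X L W \<psi> \<longleftrightarrow> (\<forall>w\<in>W. traj_sat X L w \<psi>)"

definition \<Omega> :: "real \<Rightarrow> (real ^ 'n) set" where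
  "\<Omega> \<epsilon> = {z. infnorm z \<le> \<epsilon>}"

text \<open>The trajectories of length \<open>N\<close> from \<open>x\<close> (of interest for \<open>N > 0\<close>).\<close>

definition \<xi> ::
  "nat \<Rightarrow> (real ^ 'n \<Rightarrow> real ^ 'n) \<Rightarrow> real ^ 'n \<Rightarrow> real \<Rightarrow> (real ^ 'n) list set" where
  "\<xi> N f x \<epsilon> = {w. length w = N \<and> w ! 0 = x \<and>
     (\<forall>k. Suc k < N \<longrightarrow> w ! Suc k \<in> {f (w ! k) + d | d. d \<in> \<Omega> \<epsilon>})}"

definition resilience_set ::
  "(real ^ 'n) set \<Rightarrow> (real ^ 'n \<Rightarrow> 'ap set) \<Rightarrow> nat \<Rightarrow> (real ^ 'n \<Rightarrow> real ^ 'n) \<Rightarrow>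
     'ap ltlf \<Rightarrow> real ^ 'n \<Rightarrow> real set" where
  "resilience_set X L N f \<psi> x = {\<epsilon>. 0 \<le> \<epsilon> \<and> trajs_sat X L (\<xi> N f x \<epsilon>) \<psi>}"

definition resilience ::
  "(real ^ 'n) set \<Rightarrow> (real ^ 'n \<Rightarrow> 'ap set) \<Rightarrow> nat \<Rightarrow> (real ^ 'n \<Rightarrow> real ^ 'n) \<Rightarrow>
     'ap ltlf \<Rightarrow> real ^ 'n \<Rightarrow> ennreal" where
  "resilience X L N f \<psi> x =
     (if trajs_sat X L (\<xi> N f x 0) \<psi>
      then (SUP \<epsilon>\<in>resilience_set X L N f \<psi> x. ennreal \<epsilon>) else 0)"

text \<open>
  Elementwise limits are taken in the ambient Euclidean space; since satisfaction includes
  membership in \<open>X\<close>, the limit is in particular required to stay in \<open>X\<close> (automatic when \<open>X\<close>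
  is topologically closed, such as the whole space).
\<close>

definition closed_spec ::
  "(real ^ 'n) set \<Rightarrow> (real ^ 'n \<Rightarrow> 'ap set) \<Rightarrow> nat \<Rightarrow> 'ap ltlf \<Rightarrow> bool" where
  "closed_spec X L N \<psi> \<longleftrightarrow>
     (\<forall>(W :: nat \<Rightarrow> (real ^ 'n) list) w.
        (\<forall>i. length (W i) = N) \<and> length w = N \<and>
        (\<forall>j<N. (\<lambda>i. W i ! j) \<longlonglongrightarrow> w ! j) \<and>
        (\<forall>i. traj_sat X L (W i) \<psi>) \<longrightarrow> traj_sat X L w \<psi>)"

text \<open>
  \<open>m\<close> is the maximum of a set \<open>S\<close> of nonnegative reals: an attained greatest element of \<open>S\<close>,
  or, by convention, \<open>\<infinity>\<close> if \<open>S\<close> is unbounded (no real maximum can exist then, for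
  instance for the specification \<open>true\<close>).
\<close>

definition is_max :: "real set \<Rightarrow> ennreal \<Rightarrow> bool" where
  "is_max S m \<longleftrightarrow>
     (\<exists>\<epsilon>\<in>S. (\<forall>\<epsilon>'\<in>S. \<epsilon>' \<le> \<epsilon>) \<and> m = ennreal \<epsilon>) \<or>
     (\<not> bdd_above S \<and> m = \<infinity>)"

end

theory Submission imports Defs begin

text \<open>
  Fix a trajectory \<open>w\<close> for the disturbance level \<open>s = Sup S\<close>, where \<open>S\<close> is the set of levels at
  which \<open>\<psi>\<close> holds. Rerunning the system with the disturbances of \<open>w\<close> scaled by \<open>c\<^sub>i = i / (i + 1)\<close>
  gives trajectories whose level \<open>c\<^sub>i s\<close> lies strictly below \<open>s\<close>, so they satisfy \<open>\<psi>\<close>; by continuity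
  of \<open>f\<close> they converge to \<open>w\<close>, and closedness of \<open>\<psi>\<close> passes satisfaction on to \<open>w\<close>.
\<close>

text \<open>The relation \<open>\<xi>\<close> hides the disturbances; here a trajectory becomes a
  function of them, so they can be rescaled.\<close>

primrec run :: "('a::plus \<Rightarrow> 'a) \<Rightarrow> 'a \<Rightarrow> (nat \<Rightarrow> 'a) \<Rightarrow> nat \<Rightarrow> 'a" where
  "run f x d 0 = x"
| "run f x d (Suc k) = f (run f x d k) + d k"

lemma run_in_\<xi>:
  assumes "N \<ge> 1" and "\<And>k. Suc k < N \<Longrightarrow> infnorm (d k) \<le> \<epsilon>"
  shows "map (run f x d) [0..<N] \<in> \<xi> N f x \<epsilon>"
  using assms by (auto simp: \<xi>_def \<Omega>_def)

text \<open>Every trajectory is driven by its own residuals \<open>w ! Suc j - f (w ! j)\<close>: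
  adding one back to \<open>f (w ! j)\<close> cancels.\<close>

lemma \<xi>_eq_run:
  assumes "w \<in> \<xi> N f x \<epsilon>" and "k < N"
  shows "w ! k = run f x (\<lambda>j. w ! Suc j - f (w ! j)) k"
  using assms(2)
proof (induction k)
  case 0
  then show ?case using assms(1) by (simp add: \<xi>_def)
next
  case (Suc k)
  then have "w ! k = run f x (\<lambda>j. w ! Suc j - f (w ! j)) k" by simp
  from this[symmetric] show ?case by simp
qed

lemma \<xi>_disturbance:
  assumes "w \<in> \<xi> N f x \<epsilon>" and "Suc k < N"
  shows "infnorm (w ! Suc k - f (w ! k)) \<le> \<epsilon>"
proof -
  have "w ! Suc k \<in> {f (w ! k) + d | d. d \<in> \<Omega> \<epsilon>}"
    using assms by (simp add: \<xi>_def)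
  then show ?thesis by (auto simp: \<Omega>_def)
qed

lemma \<xi>_mono:
  assumes "\<delta> \<le> \<epsilon>"
  shows "\<xi> N f x \<delta> \<subseteq> \<xi> N f x \<epsilon>"
  using assms by (fastforce simp: \<xi>_def \<Omega>_def)

text \<open>State \<open>k\<close> arises from finitely many applications of \<open>f\<close> and
  additions, so convergence of each single disturbance suffices.\<close>

lemma tendsto_run:
  fixes f :: "'a::{t2_space,topological_monoid_add} \<Rightarrow> 'a"
  assumes "continuous_on UNIV f" and "\<And>k. ((\<lambda>i. D i k) \<longlongrightarrow> d k) F"
  shows "((\<lambda>i. run f x (D i) k) \<longlongrightarrow> run f x d k) F"
proof (induction k)
  case 0
  show ?case by simp
next
  case (Suc k)
  have "isCont f (run f x d k)"
    using assms(1) by (simp add: continuous_on_eq_continuous_at)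
  then have "((\<lambda>i. f (run f x (D i) k)) \<longlongrightarrow> f (run f x d k)) F"
    using Suc by (rule isCont_tendsto_compose)
  then show ?case using assms(2) by (simp add: tendsto_add)
qed

lemma Sup_in_resilience_set:
  fixes f :: "real ^ 'n \<Rightarrow> real ^ 'n"
  assumes "N \<ge> 1" and cont: "continuous_on UNIV f" and closed: "closed_spec X L N \<psi>"
    and zero: "0 \<in> resilience_set X L N f \<psi> x"
    and bdd: "bdd_above (resilience_set X L N f \<psi> x)"
  shows "Sup (resilience_set X L N f \<psi> x) \<in> resilience_set X L N f \<psi> x"
proof -
  let ?S = "resilience_set X L N f \<psi> x"
  let ?s = "Sup ?S"
  have s_nonneg: "0 \<le> ?s" using zero bdd by (rule cSup_upper)
  show ?thesis
  \<comment> \<open>Scaling gives a strictly smaller level only if \<open>?s\<close> is positive;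
    for \<open>?s = 0\<close> the supremum is attained by \<open>zero\<close>.\<close>
  proof (cases "?s = 0")
    case True
    then show ?thesis using zero by simp
  next
    case False
    with s_nonneg have s_pos: "0 < ?s" by simp
    \<comment> \<open>Some level in \<open>?S\<close> exceeds \<open>\<delta>\<close>, and lowering
      the level only shrinks the set of trajectories.\<close>
    have below: "trajs_sat X L (\<xi> N f x \<delta>) \<psi>" if "\<delta> < ?s" for \<delta>
    proof -
      obtain \<epsilon> where "\<epsilon> \<in> ?S" "\<delta> < \<epsilon>"
        using less_cSupE[OF \<open>\<delta> < ?s\<close>] zero by blast
      then show ?thesis
        using \<xi>_mono[of \<delta> \<epsilon> N f x] by (auto simp: resilience_set_def trajs_sat_def)
    qed
    have "traj_sat X L w \<psi>" if w: "w \<in> \<xi> N f x ?s" for w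
    proof -
      define d where "d k = w ! Suc k - f (w ! k)" for k
      \<comment> \<open>What matters is that the factors lie in [0, 1) and tend to 1.\<close>
      define c :: "nat \<Rightarrow> real" where "c i = real i / real (Suc i)" for i
      define W where "W i = map (run f x (\<lambda>k. c i *\<^sub>R d k)) [0..<N]" for i
      have c: "0 \<le> c i" "c i < 1" for i by (simp_all add: c_def)
      have c_lim: "c \<longlonglongrightarrow> 1"
        unfolding c_def by (rule LIMSEQ_n_over_Suc_n)
      have "traj_sat X L (W i) \<psi>" for i
      proof -
        have "infnorm (c i *\<^sub>R d k) \<le> c i * ?s" if "Suc k < N" for k
          using \<xi>_disturbance[OF w that] c(1)[of i]
          by (simp add: infnorm_mul d_def mult_left_mono)
        then have "W i \<in> \<xi> N f x (c i * ?s)"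
          unfolding W_def by (rule run_in_\<xi>[OF \<open>N \<ge> 1\<close>])
        moreover have "c i * ?s < ?s" using c(2)[of i] s_pos by simp
        ultimately show ?thesis using below by (auto simp: trajs_sat_def)
      qed
      moreover have "(\<lambda>i. W i ! j) \<longlonglongrightarrow> w ! j" if "j < N" for j
      proof -
        have "(\<lambda>i. c i *\<^sub>R d k) \<longlonglongrightarrow> d k" for k
          using tendsto_scaleR[OF c_lim tendsto_const[of "d k"]] by simp
        then have "(\<lambda>i. run f x (\<lambda>k. c i *\<^sub>R d k) j) \<longlonglongrightarrow> run f x d j"
          by (rule tendsto_run[OF cont])
        moreover have "w ! j = run f x d j"
          unfolding d_def using \<xi>_eq_run[OF w that] .
        ultimately show ?thesis using that by (simp add: W_def)
      qed
      moreover have "length (W i) = N" for i by (simp add: W_def)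
      moreover have "length w = N" using w by (simp add: \<xi>_def)
      ultimately show ?thesis
        using closed unfolding closed_spec_def by blast
    qed
    then show ?thesis
      using s_nonneg by (simp add: resilience_set_def trajs_sat_def)
  qed
qed

text \<open>If \<open>S\<close> is bounded, monotonicity of \<open>ennreal\<close> carries the
  maximum over to the image; a finite supremum of the image would in turn bound
  \<open>S\<close>.\<close>

lemma is_max_SUP_ennreal:
  assumes "bdd_above S \<Longrightarrow> Sup S \<in> S"
  shows "is_max S (SUP \<epsilon>\<in>S. ennreal \<epsilon>)"
proof (cases "bdd_above S")
  case True
  have "(SUP \<epsilon>\<in>S. ennreal \<epsilon>) = ennreal (Sup S)"
    using assms[OF True] cSup_upper[OF _ True]
    by (intro antisym SUP_least SUP_upper) (auto intro: ennreal_leI)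
  then show ?thesis
    using assms[OF True] cSup_upper[OF _ True] by (auto simp: is_max_def)
next
  case False
  have "(SUP \<epsilon>\<in>S. ennreal \<epsilon>) = \<infinity>"
  proof (rule ccontr)
    assume "(SUP \<epsilon>\<in>S. ennreal \<epsilon>) \<noteq> \<infinity>"
    then obtain r where r: "0 \<le> r" "(SUP \<epsilon>\<in>S. ennreal \<epsilon>) = ennreal r"
      by (cases "SUP \<epsilon>\<in>S. ennreal \<epsilon>") auto
    \<comment> \<open>As \<open>0 \<le> r\<close>, the order is reflected back to the reals, even
      for a negative \<open>\<epsilon>\<close>, which \<open>ennreal\<close> sends to 0.\<close>
    have "\<epsilon> \<le> r" if "\<epsilon> \<in> S" for \<epsilon>
      using SUP_upper[OF that, of ennreal] r by (simp add: ennreal_le_iff)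
    then show False using False by (auto simp: bdd_above_def)
  qed
  then show ?thesis using False by (simp add: is_max_def)
qed

theorem proposition3p3:
  fixes X :: "(real ^ 'n) set"
    and L :: "real ^ 'n \<Rightarrow> 'ap::finite set"
    and f :: "real ^ 'n \<Rightarrow> real ^ 'n"
    and N :: nat
    and \<psi> :: "'ap ltlf"
    and x :: "real ^ 'n"
  assumes "L \<in> measurable (restrict_space borel X) (count_space UNIV)"
    and "N \<ge> 1"
    and "x \<in> X"
    and "continuous_on UNIV f"
    and "closed_spec X L N \<psi>"
  shows "if trajs_sat X L (\<xi> N f x 0) \<psi>
         then is_max {\<epsilon>. 0 \<le> \<epsilon> \<and> trajs_sat X L (\<xi> N f x \<epsilon>) \<psi>} (resilience X L N f \<psi> x)
         else resilience X L N f \<psi> x = 0"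
proof (cases "trajs_sat X L (\<xi> N f x 0) \<psi>")
  case True
  then have "0 \<in> resilience_set X L N f \<psi> x" by (simp add: resilience_set_def)
  \<comment> \<open>Level 0 belongs to the set, so boundedness alone forces the real supremum to be
    attained.\<close>
  then have "is_max (resilience_set X L N f \<psi> x) (resilience X L N f \<psi> x)"
    using True Sup_in_resilience_set[OF assms(2,4,5)]
    by (simp add: resilience_def is_max_SUP_ennreal)
  then show ?thesis using True by (simp add: resilience_set_def)
next
  case False
  then show ?thesis by (simp add: resilience_def)
qed

end
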